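(* Assume $\alpha=\gamma$ and $\alpha+\beta>1$. Then a.a.s. for all vertices $u$ of $K(n,P)$ we have $|N(u)|=(1+o(1))(\alpha+\beta)^n$ and \[\left|\left\{w\in N(u):\ H(u,w)=(1+o(1))\tfrac{\beta}{\alpha+\beta}n\right\}\right|=(1+o(1))(\alpha+\beta)^n .\]
   Context: Let $0<\alpha,\beta,\gamma<1$ be constants not depending on $n$, and $P=\begin{pmatrix}\alpha&\beta\\ \beta&\gamma\end{pmatrix}$ indexed by $\{0,1\}$ ($P_{1,1}=\alpha$, $P_{0,1}=P_{1,0}=\beta$, $P_{0,0}=\gamma$). The stochastic Kronecker graph $K(n,P)$ has vertex set $\mathbb Z_2^n$; writing $u_k$ for the $k$-th digit of $u$, each pair $\{u,v\}$ is an edge with probability $p_{u,v}=\prod_{k=1}^n P_{u_k,v_k}$, independently of all other pairs. $N(u)$ is the neighborhood of $u$ in $K(n,P)$ and $H(u,w)$ is the Hamming distance between the strings $u,w$. A.a.s. means with probability tending to $1$ as $n\to\infty$; the second statement means that there is a function $\varepsilon(n)\to0$ such that a.a.s. for every $u$ the number of $w\in N(u)$ with $|H(u,w)-\frac{\beta}{\alpha+\beta}n|\le\varepsilon(n)n$ is $(1+o(1))(\alpha+\beta)^n$. *)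

theory Defs
  imports "HOL-Probability.Probability" "HOL-Library.Z2"
begin

definition kron_matrix :: "real \<Rightarrow> real \<Rightarrow> real \<Rightarrow> bit \<Rightarrow> bit \<Rightarrow> real" where
  "kron_matrix \<alpha> \<beta> \<gamma> a b =
     (if a = 1 \<and> b = 1 then \<alpha> else if a = 0 \<and> b = 0 then \<gamma> else \<beta>)"

definition kron_vertices :: "nat \<Rightarrow> bit list set" where
  "kron_vertices n = {u. length u = n}"

definition kron_pairs :: "nat \<Rightarrow> bit list set set" where
  "kron_pairs n = {{u, v} | u v. u \<in> kron_vertices n \<and> v \<in> kron_vertices n \<and> u \<noteq> v}"

definition kron_prob :: "(bit \<Rightarrow> bit \<Rightarrow> real) \<Rightarrow> bit list \<Rightarrow> bit list \<Rightarrow> real" where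
  "kron_prob P u v = (\<Prod>k<length u. P (u ! k) (v ! k))"

text \<open>
  The probability attached to an unordered pair. It is well defined only for symmetric \<open>P\<close>;
  see \<open>kron_edge_prob_doubleton\<close> below.
\<close>

definition kron_edge_prob :: "(bit \<Rightarrow> bit \<Rightarrow> real) \<Rightarrow> bit list set \<Rightarrow> real" where
  "kron_edge_prob P e = (THE p. \<exists>u v. e = {u, v} \<and> p = kron_prob P u v)"

text \<open>The graph \<open>K(n,P)\<close>, as the distribution of its edge set.\<close>

definition kronecker_graph :: "nat \<Rightarrow> (bit \<Rightarrow> bit \<Rightarrow> real) \<Rightarrow> bit list set set pmf" where
  "kronecker_graph n P =
     map_pmf (\<lambda>f. {e \<in> kron_pairs n. f e})
       (Pi_pmf (kron_pairs n) False (\<lambda>e. bernoulli_pmf (kron_edge_prob P e)))"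

definition neighborhood :: "'a set set \<Rightarrow> 'a \<Rightarrow> 'a set" where
  "neighborhood E u = {w. {u, w} \<in> E}"

definition hamming :: "'a list \<Rightarrow> 'a list \<Rightarrow> nat" where
  "hamming u w = card {k. k < length u \<and> u ! k \<noteq> w ! k}"

lemma kron_edge_prob_doubleton:
  assumes sym: "\<And>a b. P a b = P b a" and len: "length u = length v"
  shows "kron_edge_prob P {u, v} = kron_prob P u v"
proof -
  have "kron_prob P v u = kron_prob P u v"
    unfolding kron_prob_def len using sym by (intro prod.cong) auto
  then show ?thesis
    unfolding kron_edge_prob_def by (intro the_equality) (auto simp: doubleton_eq_iff)
qed

lemma kron_matrix_sym: "kron_matrix \<alpha> \<beta> \<gamma> a b = kron_matrix \<alpha> \<beta> \<gamma> b a"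
  by (auto simp: kron_matrix_def)

end

theory Submission
  imports Defs "HOL-Real_Asymp.Real_Asymp"
begin

text \<open>
  For \<open>\<alpha> = \<gamma>\<close> the edge probability of \<open>u, w\<close> depends only on their Hamming distance, and
  \<open>\<Sum>w. p u w = (\<alpha> + \<beta>)^n\<close>; normalising these weights makes the distance
  binomially distributed with success probability \<open>\<beta> / (\<alpha> + \<beta>)\<close>. By Chebyshev all but a vanishing fraction
  of the mass lies within \<open>n powr (3/4)\<close> of the mean distance. The (band) degree of \<open>u\<close> is a sum of
  independent Bernoulli variables with mean \<open>(1 + o(1)) (\<alpha> + \<beta>)^n\<close>, which is exponentially large, so
  a multiplicative Chernoff bound with relative deviation \<open>1/n\<close> survives the union bound over the
  \<open>2^n\<close> vertices.
\<close>

section \<open>Chernoff bound for independent Bernoulli variables\<close>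

lemma exp_le_quadratic:
  fixes x :: real
  assumes "\<bar>x\<bar> \<le> 1"
  shows "exp x \<le> 1 + x + x\<^sup>2"
proof (cases "0 \<le> x")
  case True
  then show ?thesis using assms by (intro exp_bound) auto
next
  case False
  define y where "y = - x"
  have y: "0 \<le> y" using False by (simp add: y_def)
  have pos: "0 < 1 + y + y\<^sup>2 / 2" using y by (simp add: add_pos_nonneg)
  \<comment> \<open>For negative \<open>x\<close>, bound \<open>exp x = 1 / exp y\<close> by the
    reciprocal of the quadratic Taylor minorant of \<open>exp y\<close>. The product shows that
    \<open>1 - y + y^2\<close> dominates this reciprocal: the linear terms cancel and the rest is
    nonnegative.\<close>
  have "(1 - y + y\<^sup>2) * (1 + y + y\<^sup>2 / 2) = 1 + y^2/2 + y^3/2 + y^4/2"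
    by (simp add: field_simps power2_eq_square power3_eq_cube power4_eq_xxxx)
  also have "\<dots> \<ge> 1" using y by simp
  finally have "1 / (1 + y + y\<^sup>2 / 2) \<le> 1 - y + y\<^sup>2"
    using pos by (simp add: divide_le_eq)
  moreover have "exp x \<le> 1 / (1 + y + y\<^sup>2 / 2)"
    using exp_lower_Taylor_quadratic[OF y] pos
    by (simp add: y_def exp_minus field_simps)
  ultimately show ?thesis by (simp add: y_def)
qed

text \<open>Independence factors the moment generating function over the pairs. Each factor is at
  most \<open>exp (p e * (l + l^2))\<close>, and centring cancels the part linear in
  \<open>l\<close>.\<close>

lemma bernoulli_sum_mgf_bound:
  fixes p :: "'a \<Rightarrow> real"
  assumes A: "finite A" "F \<subseteq> A" and p: "\<And>e. e \<in> A \<Longrightarrow> 0 \<le> p e \<and> p e \<le> 1"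
    and l: "\<bar>l\<bar> \<le> 1"
  shows "measure_pmf.expectation (Pi_pmf A False (\<lambda>e. bernoulli_pmf (p e)))
           (\<lambda>f. exp (l * (real (card {e \<in> F. f e}) - sum p F))) \<le> exp (l\<^sup>2 * sum p F)"
proof -
  \<comment> \<open>Pairs outside \<open>F\<close> contribute the factor 1, so the product runs over
    all of \<open>A\<close>, as independence under \<open>Pi_pmf\<close> requires.\<close>
  define g where "g e b = (if e \<in> F \<and> b then exp l else 1)" for e :: 'a and b
  have F: "finite F" using A finite_subset by auto
  have *: "exp (l * (real (card {e \<in> F. f e}) - sum p F)) =
      exp (- l * sum p F) * (\<Prod>e\<in>A. g e (f e))" for f
  proof -
    have "(\<Prod>e\<in>A. g e (f e)) = (\<Prod>e\<in>{e \<in> F. f e}. exp l)"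
      using A by (intro prod.mono_neutral_cong_right) (auto simp: g_def)
    also have "\<dots> = exp (l * real (card {e \<in> F. f e}))"
      by (simp add: exp_of_nat2_mult)
    finally show ?thesis by (simp add: exp_add[symmetric] algebra_simps)
  qed
  have "measure_pmf.expectation (Pi_pmf A False (\<lambda>e. bernoulli_pmf (p e))) (\<lambda>f. \<Prod>e\<in>A. g e (f e))
      = (\<Prod>e\<in>A. measure_pmf.expectation (bernoulli_pmf (p e)) (g e))"
    using A by (intro expectation_prod_Pi_pmf integrable_measure_pmf_finite) (auto simp: g_def)
  also have "\<dots> = (\<Prod>e\<in>F. p e * exp l + (1 - p e))"
    using A p by (intro prod.mono_neutral_cong_right) (auto simp: g_def)
  also have "\<dots> \<le> (\<Prod>e\<in>F. exp (p e * (l + l\<^sup>2)))"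
  proof (intro prod_mono conjI)
    fix e assume "e \<in> F"
    then have pe: "0 \<le> p e" "p e \<le> 1" using p A by auto
    show "0 \<le> p e * exp l + (1 - p e)" using pe by simp
    have "p e * exp l \<le> p e * (1 + l + l\<^sup>2)"
      using pe exp_le_quadratic[OF l] by (intro mult_left_mono)
    then have "p e * exp l + (1 - p e) \<le> 1 + p e * (l + l\<^sup>2)" by (simp add: algebra_simps)
    also have "\<dots> \<le> exp (p e * (l + l\<^sup>2))" by (rule exp_ge_add_one_self)
    finally show "p e * exp l + (1 - p e) \<le> exp (p e * (l + l\<^sup>2))" .
  qed
  also have "\<dots> = exp ((l + l\<^sup>2) * sum p F)"
    using F by (simp add: exp_sum[symmetric] sum_distrib_right mult.commute[of _ "sum p F"])
  finally show ?thesis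
    unfolding * by (simp add: exp_minus field_simps exp_add distrib_right)
qed

text \<open>\<open>M\<close> only bounds the mean from above, so that deviations of different sets
  \<open>F\<close> can all be measured on one common scale.\<close>

lemma bernoulli_sum_chernoff:
  fixes p :: "'a \<Rightarrow> real"
  assumes A: "finite A" "F \<subseteq> A" and p: "\<And>e. e \<in> A \<Longrightarrow> 0 \<le> p e \<and> p e \<le> 1"
    and M: "sum p F \<le> M" and t: "0 \<le> t" "t \<le> 2"
  shows "measure_pmf.prob (Pi_pmf A False (\<lambda>e. bernoulli_pmf (p e)))
           {f. \<bar>real (card {e \<in> F. f e}) - sum p F\<bar> > t * M} \<le> 2 * exp (- M * t\<^sup>2 / 4)"
proof -
  let ?Q = "Pi_pmf A False (\<lambda>e. bernoulli_pmf (p e))"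
  define Y where "Y f = real (card {e \<in> F. f e}) - sum p F" for f
  have fin: "finite (set_pmf ?Q)"
    using A by (intro finite_subset[OF set_Pi_pmf_subset'] finite_PiE_dflt) auto
  \<comment> \<open>Markov's inequality for \<open>exp (l * Y f)\<close>. The size
    \<open>t / 2\<close> of \<open>l\<close> minimises the exponent
    \<open>l^2 * M - l * t * M\<close>, and \<open>t \<le> 2\<close> gives
    \<open>\<bar>l\<bar> \<le> 1\<close>; the two signs of \<open>l\<close> give the two
    tails.\<close>
  have tail: "measure_pmf.prob ?Q {f. l * Y f \<ge> t\<^sup>2 / 2 * M} \<le> exp (- M * t\<^sup>2 / 4)"
    if l: "\<bar>l\<bar> = t / 2" for l
  proof -
    have "measure_pmf.prob ?Q {f. l * Y f \<ge> t\<^sup>2 / 2 * M}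
        = measure_pmf.prob ?Q {f \<in> space (measure_pmf ?Q). exp (l * Y f) \<ge> exp (t\<^sup>2 / 2 * M)}"
      by simp
    also have "\<dots> \<le> measure_pmf.expectation ?Q (\<lambda>f. exp (l * Y f)) / exp (t\<^sup>2 / 2 * M)"
      by (rule integral_Markov_inequality_measure[where A = "{}"])
         (auto intro!: integrable_measure_pmf_finite fin)
    also have "\<dots> \<le> exp (l\<^sup>2 * sum p F) / exp (t\<^sup>2 / 2 * M)"
      unfolding Y_def using l t by (intro divide_right_mono bernoulli_sum_mgf_bound A p) auto
    also have "\<dots> \<le> exp (l\<^sup>2 * M) / exp (t\<^sup>2 / 2 * M)"
      using M by (intro divide_right_mono) (auto intro: mult_left_mono)
    also have "l\<^sup>2 = t\<^sup>2 / 4"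
      using l by (metis power2_abs power_divide power2_eq_square mult_2 numeral_Bit0)
    also have "exp (t\<^sup>2 / 4 * M) / exp (t\<^sup>2 / 2 * M) = exp (- M * t\<^sup>2 / 4)"
      by (simp add: exp_diff[symmetric] field_simps)
    finally show ?thesis .
  qed
  have "measure_pmf.prob ?Q {f. \<bar>Y f\<bar> > t * M}
      \<le> measure_pmf.prob ?Q ({f. t / 2 * Y f \<ge> t\<^sup>2 / 2 * M} \<union> {f. - (t / 2) * Y f \<ge> t\<^sup>2 / 2 * M})"
  proof (intro measure_pmf.finite_measure_mono subsetI)
    fix f assume "f \<in> {f. \<bar>Y f\<bar> > t * M}"
    then have "t * M \<le> Y f \<or> t * M \<le> - Y f" by auto
    then have "t / 2 * (t * M) \<le> t / 2 * Y f \<or> t / 2 * (t * M) \<le> t / 2 * (- Y f)"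
      using t mult_left_mono[of _ _ "t / 2"] by fastforce
    then show "f \<in> {f. t / 2 * Y f \<ge> t\<^sup>2 / 2 * M} \<union> {f. - (t / 2) * Y f \<ge> t\<^sup>2 / 2 * M}"
      by (auto simp: power2_eq_square)
  qed auto
  also have "\<dots> \<le> measure_pmf.prob ?Q {f. t / 2 * Y f \<ge> t\<^sup>2 / 2 * M}
      + measure_pmf.prob ?Q {f. - (t / 2) * Y f \<ge> t\<^sup>2 / 2 * M}"
    by (intro measure_Un_le) auto
  also have "\<dots> \<le> 2 * exp (- M * t\<^sup>2 / 4)"
    using tail[of "t / 2"] tail[of "- (t / 2)"] t by simp
  finally show ?thesis by (simp add: Y_def)
qed

section \<open>Vertices, pairs and degrees\<close>

lemma sum_Un_le:
  fixes f :: "'a \<Rightarrow> real"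
  assumes "finite A" "finite B" "\<And>x. 0 \<le> f x"
  shows "sum f (A \<union> B) \<le> sum f A + sum f B"
  using assms by (simp add: sum_Un sum_nonneg)

lemma finite_kron_vertices: "finite (kron_vertices n)"
  and card_kron_vertices: "card (kron_vertices n) = 2 ^ n"
proof -
  have U: "(UNIV :: bit set) = {0, 1}" using bit_not_one_iff by auto
  show "finite (kron_vertices n)" "card (kron_vertices n) = 2 ^ n"
    using finite_lists_length_eq[of "UNIV :: bit set" n] card_lists_length_eq[of "UNIV :: bit set" n]
    by (simp_all add: kron_vertices_def U) (simp_all flip: U add: numeral_2_eq_2)
qed

lemma finite_kron_pairs: "finite (kron_pairs n)"
  by (rule finite_subset[of _ "Pow (kron_vertices n)"])
     (auto simp: kron_pairs_def finite_kron_vertices)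

lemma kron_prob_bounds:
  assumes "\<And>a b. 0 \<le> P a b \<and> P a b \<le> 1"
  shows "0 \<le> kron_prob P u v" and "kron_prob P u v \<le> 1"
  using assms by (auto simp: kron_prob_def intro!: prod_nonneg prod_le_1)

text \<open>For fixed \<open>u\<close> the map from \<open>w\<close> to \<open>{u, w}\<close> is
  injective, so the neighbors of \<open>u\<close> in \<open>W\<close> are counted by independent
  indicators of distinct pairs.\<close>

lemma kronecker_degree_chernoff:
  assumes sym: "\<And>a b. P a b = P b a" and P: "\<And>a b. 0 \<le> P a b \<and> P a b \<le> 1"
    and u: "u \<in> kron_vertices n" and W: "W \<subseteq> kron_vertices n - {u}"
    and M: "(\<Sum>w\<in>W. kron_prob P u w) \<le> M" and t: "0 \<le> t" "t \<le> 2"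
  shows "measure_pmf.prob (kronecker_graph n P)
           {E. \<bar>real (card (W \<inter> neighborhood E u)) - (\<Sum>w\<in>W. kron_prob P u w)\<bar> > t * M}
         \<le> 2 * exp (- M * t\<^sup>2 / 4)"
proof -
  let ?p = "kron_edge_prob P"
  define F where "F = (\<lambda>w. {u, w}) ` W"
  have inj: "inj_on (\<lambda>w. {u, w}) S" for S
    by (auto simp: inj_on_def doubleton_eq_iff)
  have FA: "F \<subseteq> kron_pairs n" using u W by (fastforce simp: F_def kron_pairs_def)
  have doub: "?p {v, w} = kron_prob P v w" if "v \<in> kron_vertices n" "w \<in> kron_vertices n" for v w
    using that by (intro kron_edge_prob_doubleton sym) (auto simp: kron_vertices_def)
  have p: "0 \<le> ?p e \<and> ?p e \<le> 1" if "e \<in> kron_pairs n" for e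
    using that kron_prob_bounds[of P, OF P] by (auto simp: kron_pairs_def doub)
  have sum: "sum ?p F = (\<Sum>w\<in>W. kron_prob P u w)"
    unfolding F_def using u W by (subst sum.reindex[OF inj]) (auto intro!: sum.cong doub)
  have card: "card (W \<inter> neighborhood {e \<in> kron_pairs n. f e} u) = card {e \<in> F. f e}" for f
  proof -
    have "{e \<in> F. f e} = (\<lambda>w. {u, w}) ` (W \<inter> neighborhood {e \<in> kron_pairs n. f e} u)"
      using FA by (auto simp: F_def neighborhood_def)
    then show ?thesis by (simp add: card_image[OF inj])
  qed
  show ?thesis
    using bernoulli_sum_chernoff[OF finite_kron_pairs FA, where p = ?p and M = M and t = t] p M t
    by (simp add: kronecker_graph_def sum card vimage_def)
qed

section \<open>Hamming distance under the edge weights\<close>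

lemma sum_kron_vertices_Suc:
  "(\<Sum>w\<in>kron_vertices (Suc n). f w) =
     (\<Sum>w\<in>kron_vertices n. f (0 # w)) + (\<Sum>w\<in>kron_vertices n. f (1 # w))"
proof -
  have "kron_vertices (Suc n) = (#) 0 ` kron_vertices n \<union> (#) 1 ` kron_vertices n"
  proof (intro set_eqI)
    fix w show "w \<in> kron_vertices (Suc n) \<longleftrightarrow> w \<in> (#) 0 ` kron_vertices n \<union> (#) 1 ` kron_vertices n"
      by (cases w; cases "hd w") (auto simp: kron_vertices_def)
  qed
  then have "(\<Sum>w\<in>kron_vertices (Suc n). f w) =
      sum f ((#) 0 ` kron_vertices n) + sum f ((#) 1 ` kron_vertices n)"
    by (simp only:) (intro sum.union_disjoint; auto simp: finite_kron_vertices)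
  then show ?thesis by (simp add: sum.reindex)
qed

lemma kron_prob_Cons: "kron_prob P (a # u) (b # w) = P a b * kron_prob P u w"
  unfolding kron_prob_def by (simp add: prod.lessThan_Suc_shift del: prod.lessThan_Suc)

lemma hamming_Cons: "hamming (a # u) (b # w) = of_bool (a \<noteq> b) + hamming u w"
proof -
  have *: "{k. k < length (a # u) \<and> (a # u) ! k \<noteq> (b # w) ! k} =
      (if a \<noteq> b then {0} else {}) \<union> Suc ` {k. k < length u \<and> u ! k \<noteq> w ! k}"
    by (auto simp: less_Suc_eq_0_disj)
  then show ?thesis
    unfolding hamming_def by (subst *, subst card_Un_disjoint) (auto simp: card_image)
qed

text \<open>Equal diagonal entries make the recursion independent of the digit \<open>a\<close>:
  agreement has weight \<open>\<alpha>\<close>, disagreement has weight \<open>\<beta>\<close> and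
  raises the distance by one.\<close>

lemma sum_kron_prob_Cons:
  fixes f :: "nat \<Rightarrow> real"
  shows "(\<Sum>w\<in>kron_vertices (Suc n). kron_prob (kron_matrix \<alpha> \<beta> \<alpha>) (a # u) w * f (hamming (a # u) w)) =
    \<alpha> * (\<Sum>w\<in>kron_vertices n. kron_prob (kron_matrix \<alpha> \<beta> \<alpha>) u w * f (hamming u w)) +
    \<beta> * (\<Sum>w\<in>kron_vertices n. kron_prob (kron_matrix \<alpha> \<beta> \<alpha>) u w * f (Suc (hamming u w)))"
  by (cases a) (simp_all add: sum_kron_vertices_Suc kron_prob_Cons hamming_Cons kron_matrix_def
      sum_distrib_left mult.assoc)

lemma sum_kron_prob:
  assumes "u \<in> kron_vertices n"
  shows "(\<Sum>w\<in>kron_vertices n. kron_prob (kron_matrix \<alpha> \<beta> \<alpha>) u w) = (\<alpha> + \<beta>) ^ n"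
  using assms
proof (induction n arbitrary: u)
  case 0
  then show ?case by (simp add: kron_vertices_def kron_prob_def)
next
  case (Suc n)
  then obtain a v where u: "u = a # v" and v: "v \<in> kron_vertices n"
    by (cases u) (auto simp: kron_vertices_def)
  show ?case
    using sum_kron_prob_Cons[where f = "\<lambda>_. 1"] Suc.IH[OF v]
    by (simp add: u algebra_simps)
qed

text \<open>The right-hand side is \<open>(\<alpha> + \<beta>) ^ n\<close> times variance plus squared bias of a binomial
  distribution; the free centre \<open>c\<close> is needed because the induction step shifts it to \<open>c - 1\<close>.\<close>

lemma sum_kron_prob_hamming_square:
  fixes \<alpha> \<beta> c :: real
  assumes "u \<in> kron_vertices n" and q: "\<alpha> + \<beta> \<noteq> 0" "q = \<beta> / (\<alpha> + \<beta>)"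
  shows "(\<Sum>w\<in>kron_vertices n. kron_prob (kron_matrix \<alpha> \<beta> \<alpha>) u w * (real (hamming u w) - c)\<^sup>2)
    = (\<alpha> + \<beta>) ^ n * (real n * q * (1 - q) + (real n * q - c)\<^sup>2)"
  using assms(1)
proof (induction n arbitrary: u c)
  case 0
  then show ?case by (simp add: kron_vertices_def kron_prob_def hamming_def)
next
  case (Suc n)
  then obtain x v where u: "u = x # v" and v: "v \<in> kron_vertices n"
    by (cases u) (auto simp: kron_vertices_def)
  define s where "s = \<alpha> + \<beta>"
  \<comment> \<open>In the variables \<open>s\<close> and \<open>q\<close> the induction step
    becomes a polynomial identity.\<close>
  have b: "\<beta> = s * q" and a: "\<alpha> = s * (1 - q)" using q by (auto simp: s_def field_simps)
  have shift: "real (Suc h) - c = real h - (c - 1)" for h by simp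
  have "(\<Sum>w\<in>kron_vertices (Suc n). kron_prob (kron_matrix \<alpha> \<beta> \<alpha>) u w * (real (hamming u w) - c)\<^sup>2)
    = \<alpha> * (s ^ n * (real n * q * (1 - q) + (real n * q - c)\<^sup>2)) +
      \<beta> * (s ^ n * (real n * q * (1 - q) + (real n * q - (c - 1))\<^sup>2))"
    unfolding u sum_kron_prob_Cons[where f = "\<lambda>h. (real h - c)\<^sup>2"]
    by (simp only: shift Suc.IH[OF v] s_def)
  also have "\<dots> = s ^ Suc n * (real (Suc n) * q * (1 - q) + (real (Suc n) * q - c)\<^sup>2)"
    unfolding a b by (simp add: power2_eq_square algebra_simps)
  finally show ?case by (simp add: s_def)
qed

text \<open>Chebyshev's inequality for the weights: centring at the mean \<open>q * real n\<close>
  removes the bias term of the second moment, and \<open>q * (1 - q) \<le> 1\<close>.\<close>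

lemma sum_kron_prob_far:
  fixes \<alpha> \<beta> r :: real
  assumes ab: "0 < \<alpha>" "\<alpha> \<le> 1" "0 < \<beta>" "\<beta> \<le> 1" and u: "u \<in> kron_vertices n" and r: "0 < r"
  shows "(\<Sum>w | w \<in> kron_vertices n \<and> \<not> \<bar>real (hamming u w) - \<beta> / (\<alpha> + \<beta>) * real n\<bar> \<le> r.
            kron_prob (kron_matrix \<alpha> \<beta> \<alpha>) u w) \<le> (\<alpha> + \<beta>) ^ n * (real n / r\<^sup>2)"
proof -
  define q where "q = \<beta> / (\<alpha> + \<beta>)"
  let ?k = "kron_prob (kron_matrix \<alpha> \<beta> \<alpha>) u"
  let ?B = "{w. w \<in> kron_vertices n \<and> \<not> \<bar>real (hamming u w) - \<beta> / (\<alpha> + \<beta>) * real n\<bar> \<le> r}"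
  have k: "0 \<le> ?k w" for w
    using ab by (intro kron_prob_bounds) (auto simp: kron_matrix_def)
  have "r\<^sup>2 * sum ?k ?B = (\<Sum>w\<in>?B. ?k w * r\<^sup>2)" by (simp add: sum_distrib_left mult.commute)
  also have "\<dots> \<le> (\<Sum>w\<in>?B. ?k w * (real (hamming u w) - q * real n)\<^sup>2)"
    using k r by (intro sum_mono mult_left_mono) (auto simp: q_def abs_le_square_iff[symmetric])
  also have "\<dots> \<le> (\<Sum>w\<in>kron_vertices n. ?k w * (real (hamming u w) - q * real n)\<^sup>2)"
    using k by (intro sum_mono2) (auto simp: finite_kron_vertices)
  also have "\<dots> = (\<alpha> + \<beta>) ^ n * (real n * (q * (1 - q)))"
    using sum_kron_prob_hamming_square[OF u _ q_def, of "q * real n"] ab by (simp add: mult_ac)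
  also have "\<dots> \<le> (\<alpha> + \<beta>) ^ n * (real n * 1)"
    using ab by (intro mult_left_mono mult_le_one) (auto simp: q_def)
  finally show ?thesis using r by (simp add: field_simps)
qed

section \<open>Tail bound for band degrees\<close>

lemma kron_prob_self: "kron_prob (kron_matrix \<alpha> \<beta> \<alpha>) u u = \<alpha> ^ length u"
proof -
  have "kron_matrix \<alpha> \<beta> \<alpha> a a = \<alpha>" for a by (cases a) (auto simp: kron_matrix_def)
  then show ?thesis by (simp add: kron_prob_def)
qed

text \<open>Besides the Chernoff deviation \<open>t\<close>, the error accounts for the missing vertex \<open>u\<close> and,
  by Chebyshev, for the vertices of \<open>kron_vertices n\<close> outside the Hamming band of radius \<open>r\<close>.\<close>

lemma kronecker_band_degree_tail:
  fixes \<alpha> \<beta> r t :: real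
  assumes ab: "0 < \<alpha>" "\<alpha> \<le> 1" "0 < \<beta>" "\<beta> \<le> 1" and u: "u \<in> kron_vertices n"
    and r: "0 < r" and t: "0 \<le> t" "t \<le> 2"
    and W: "W \<subseteq> kron_vertices n - {u}"
      "{w \<in> kron_vertices n - {u}. \<bar>real (hamming u w) - \<beta> / (\<alpha> + \<beta>) * real n\<bar> \<le> r} \<subseteq> W"
  shows "measure_pmf.prob (kronecker_graph n (kron_matrix \<alpha> \<beta> \<alpha>))
      {E. \<not> \<bar>real (card (W \<inter> neighborhood E u)) - (\<alpha> + \<beta>) ^ n\<bar>
          \<le> (t + (\<alpha> / (\<alpha> + \<beta>)) ^ n + real n / r\<^sup>2) * (\<alpha> + \<beta>) ^ n}
    \<le> 2 * exp (- ((\<alpha> + \<beta>) ^ n) * t\<^sup>2 / 4)"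
proof -
  let ?k = "kron_prob (kron_matrix \<alpha> \<beta> \<alpha>) u"
  let ?B = "{w. w \<in> kron_vertices n \<and> \<not> \<bar>real (hamming u w) - \<beta> / (\<alpha> + \<beta>) * real n\<bar> \<le> r}"
  let ?M = "(\<alpha> + \<beta>) ^ n"
  have P: "0 \<le> kron_matrix \<alpha> \<beta> \<alpha> a b \<and> kron_matrix \<alpha> \<beta> \<alpha> a b \<le> 1" for a b
    using ab by (auto simp: kron_matrix_def)
  note k = kron_prob_bounds(1)[of "kron_matrix \<alpha> \<beta> \<alpha>", OF P]
  note fin = finite_kron_vertices[of n]
  have upper: "sum ?k W \<le> ?M"
    unfolding sum_kron_prob[OF u, of \<alpha> \<beta>, symmetric] using W k fin by (intro sum_mono2) auto
  \<comment> \<open>\<open>W\<close>, \<open>u\<close> and the far vertices cover everything. They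
    may overlap, since \<open>W\<close> can be any set between the band and all vertices other than
    \<open>u\<close>; hence only subadditivity is used.\<close>
  have "?M = sum ?k (kron_vertices n)" by (simp add: sum_kron_prob u)
  also have "\<dots> \<le> sum ?k (W \<union> ({u} \<union> ?B))"
    using W k fin finite_subset[OF W(1)] by (intro sum_mono2) auto
  also have "\<dots> \<le> sum ?k W + sum ?k ({u} \<union> ?B)"
    using k fin finite_subset[OF W(1)] by (intro sum_Un_le) auto
  also have "\<dots> \<le> sum ?k W + (sum ?k {u} + sum ?k ?B)"
    using k fin by (intro add_left_mono sum_Un_le) auto
  finally have "?M \<le> sum ?k W + (\<alpha> ^ n + ?M * (real n / r\<^sup>2))"
    using u sum_kron_prob_far[OF ab u r] by (simp add: kron_prob_self kron_vertices_def)
  \<comment> \<open>The weight of \<open>u\<close> itself, rewritten as an error relative to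
    \<open>?M\<close>.\<close>
  moreover have "\<alpha> ^ n = (\<alpha> / (\<alpha> + \<beta>)) ^ n * ?M"
    using ab by (simp add: power_divide)
  ultimately have lower: "?M - sum ?k W \<le> ((\<alpha> / (\<alpha> + \<beta>)) ^ n + real n / r\<^sup>2) * ?M"
    by (simp add: algebra_simps)
  have "measure_pmf.prob (kronecker_graph n (kron_matrix \<alpha> \<beta> \<alpha>))
      {E. \<not> \<bar>real (card (W \<inter> neighborhood E u)) - ?M\<bar>
          \<le> (t + (\<alpha> / (\<alpha> + \<beta>)) ^ n + real n / r\<^sup>2) * ?M}
    \<le> measure_pmf.prob (kronecker_graph n (kron_matrix \<alpha> \<beta> \<alpha>))
      {E. \<bar>real (card (W \<inter> neighborhood E u)) - sum ?k W\<bar> > t * ?M}"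
    using lower upper
    by (intro measure_pmf.finite_measure_mono) (auto simp: distrib_right)
  also have "\<dots> \<le> 2 * exp (- ?M * t\<^sup>2 / 4)"
    by (intro kronecker_degree_chernoff kron_matrix_sym P u W upper t)
  finally show ?thesis .
qed

section \<open>Union bound over the vertices and limit\<close>

lemma neighborhood_kronecker_graph_subset:
  assumes "E \<in> set_pmf (kronecker_graph n P)" and "u \<in> kron_vertices n"
  shows "neighborhood E u \<subseteq> kron_vertices n - {u}"
proof
  fix w assume "w \<in> neighborhood E u"
  moreover have "E \<subseteq> kron_pairs n"
    using assms(1) unfolding kronecker_graph_def set_map_pmf by blast
  ultimately have "{u, w} \<in> kron_pairs n" unfolding neighborhood_def by blast
  then obtain a b where "{u, w} = {a, b}" "a \<in> kron_vertices n" "b \<in> kron_vertices n" "a \<noteq> b"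
    unfolding kron_pairs_def by blast
  then show "w \<in> kron_vertices n - {u}" by (auto simp: doubleton_eq_iff)
qed

text \<open>The null sequences are fixed before \<open>E\<close> and \<open>u\<close>, so each o(1)
  is deterministic and uniform over the vertices.\<close>

theorem theorem4:
  fixes \<alpha> \<beta> \<gamma> :: real
  assumes "0 < \<alpha>" "\<alpha> < 1" "0 < \<beta>" "\<beta> < 1" "0 < \<gamma>" "\<gamma> < 1"
    and "\<alpha> = \<gamma>" and "\<alpha> + \<beta> > 1"
  shows "\<exists>\<delta> \<delta>' \<epsilon> :: nat \<Rightarrow> real.
    \<delta> \<longlonglongrightarrow> 0 \<and> \<delta>' \<longlonglongrightarrow> 0 \<and> \<epsilon> \<longlonglongrightarrow> 0 \<and>
    (\<lambda>n. measure_pmf.prob (kronecker_graph n (kron_matrix \<alpha> \<beta> \<gamma>))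
       {E. \<forall>u \<in> kron_vertices n.
          \<bar>real (card (neighborhood E u)) - (\<alpha> + \<beta>) ^ n\<bar> \<le> \<delta> n * (\<alpha> + \<beta>) ^ n \<and>
          \<bar>real (card {w \<in> neighborhood E u.
                \<bar>real (hamming u w) - \<beta> / (\<alpha> + \<beta>) * real n\<bar> \<le> \<epsilon> n * real n})
             - (\<alpha> + \<beta>) ^ n\<bar> \<le> \<delta>' n * (\<alpha> + \<beta>) ^ n})
      \<longlonglongrightarrow> 1"
proof -
  define s where "s = \<alpha> + \<beta>"
  \<comment> \<open>The band radius becomes \<open>real n powr (3 / 4)\<close> and the Chebyshev
    error \<open>real n powr (- 1 / 2)\<close>; any radius exponent strictly between 1/2 and 1 would
    do.\<close>
  define \<epsilon> where "\<epsilon> n = real n powr (- 1 / 4)" for n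
  define \<delta> where "\<delta> n = 1 / real n + (\<alpha> / s) ^ n + real n / (\<epsilon> n * real n)\<^sup>2" for n
  define K where "K n = kronecker_graph n (kron_matrix \<alpha> \<beta> \<alpha>)" for n
  define band where "band n u = {w \<in> kron_vertices n - {u}.
      \<bar>real (hamming u w) - \<beta> / (\<alpha> + \<beta>) * real n\<bar> \<le> \<epsilon> n * real n}" for n u
  define bad where "bad n u W = {E. \<not> \<bar>real (card (W \<inter> neighborhood E u)) - s ^ n\<bar> \<le> \<delta> n * s ^ n}"
    for n and u :: "bit list" and W
  define good where "good n = {E. \<forall>u \<in> kron_vertices n.
          \<bar>real (card (neighborhood E u)) - (\<alpha> + \<beta>) ^ n\<bar> \<le> \<delta> n * (\<alpha> + \<beta>) ^ n \<and>
          \<bar>real (card {w \<in> neighborhood E u.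
                \<bar>real (hamming u w) - \<beta> / (\<alpha> + \<beta>) * real n\<bar> \<le> \<epsilon> n * real n})
             - (\<alpha> + \<beta>) ^ n\<bar> \<le> \<delta> n * (\<alpha> + \<beta>) ^ n}" for n
  have s: "1 < s" using assms by (simp add: s_def)
  have \<epsilon>: "\<epsilon> \<longlonglongrightarrow> 0" unfolding \<epsilon>_def by real_asymp
  have "(\<lambda>n. (\<alpha> / s) ^ n) \<longlonglongrightarrow> 0"
    using assms by (intro LIMSEQ_realpow_zero) (auto simp: s_def)
  moreover have "(\<lambda>n. 1 / real n) \<longlonglongrightarrow> 0" by real_asymp
  moreover have "(\<lambda>n. real n / (\<epsilon> n * real n)\<^sup>2) \<longlonglongrightarrow> 0" unfolding \<epsilon>_def by real_asymp
  ultimately have \<delta>: "\<delta> \<longlonglongrightarrow> 0"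
    unfolding \<delta>_def by (auto intro!: tendsto_add_zero)
  \<comment> \<open>One bound serves both claims: \<open>W\<close> will be all vertices other than
    \<open>u\<close> for the degree and \<open>band n u\<close> for the distance, with
    \<open>t = 1 / n\<close>.\<close>
  have bad: "measure_pmf.prob (K n) (bad n u W) \<le> 2 * exp (- (s ^ n) * (1 / real n)\<^sup>2 / 4)"
    if "n > 0" "u \<in> kron_vertices n" "band n u \<subseteq> W" "W \<subseteq> kron_vertices n - {u}" for n u W
    unfolding bad_def K_def \<delta>_def s_def
    using that assms
    by (intro kronecker_band_degree_tail) (auto simp: band_def \<epsilon>_def divide_le_eq)
  have lower: "1 - 2 ^ n * (4 * exp (- (s ^ n) * (1 / real n)\<^sup>2 / 4)) \<le> measure_pmf.prob (K n) (good n)"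
    if n: "n > 0" for n
  proof -
    let ?U = "\<Union>u\<in>kron_vertices n. bad n u (kron_vertices n - {u}) \<union> bad n u (band n u)"
    have "E \<in> good n" if E: "E \<in> set_pmf (K n)" "E \<notin> ?U" for E
    proof -
      have "(kron_vertices n - {u}) \<inter> neighborhood E u = neighborhood E u"
        "band n u \<inter> neighborhood E u = {w \<in> neighborhood E u.
                \<bar>real (hamming u w) - \<beta> / (\<alpha> + \<beta>) * real n\<bar> \<le> \<epsilon> n * real n}"
        if "u \<in> kron_vertices n" for u
        using neighborhood_kronecker_graph_subset[OF E(1)[unfolded K_def] that]
        by (auto simp: band_def)
      then show ?thesis using E(2) by (auto simp: good_def bad_def s_def)
    qed
    \<comment> \<open>The inclusion holds only on the support, where neighborhoods consist of
      vertices other than \<open>u\<close>; hence the almost-everywhere form of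
      monotonicity.\<close>
    then have "measure_pmf.prob (K n) (- good n) \<le> measure_pmf.prob (K n) ?U"
      by (intro measure_pmf.finite_measure_mono_AE) (auto simp: AE_measure_pmf_iff)
    also have "\<dots> \<le> (\<Sum>u\<in>kron_vertices n. measure_pmf.prob (K n)
        (bad n u (kron_vertices n - {u}) \<union> bad n u (band n u)))"
      by (intro measure_UNION_le) (auto simp: finite_kron_vertices)
    also have "\<dots> \<le> (\<Sum>u\<in>kron_vertices n. 4 * exp (- (s ^ n) * (1 / real n)\<^sup>2 / 4))"
    proof (intro sum_mono)
      fix u assume u: "u \<in> kron_vertices n"
      have "band n u \<subseteq> kron_vertices n - {u}" by (auto simp: band_def)
      then show "measure_pmf.prob (K n) (bad n u (kron_vertices n - {u}) \<union> bad n u (band n u))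
          \<le> 4 * exp (- (s ^ n) * (1 / real n)\<^sup>2 / 4)"
        using bad[OF n u, of "kron_vertices n - {u}"] bad[OF n u, of "band n u"]
          measure_Un_le[of "bad n u (kron_vertices n - {u})" "K n" "bad n u (band n u)"]
        by simp
    qed
    also have "\<dots> = 2 ^ n * (4 * exp (- (s ^ n) * (1 / real n)\<^sup>2 / 4))"
      by (simp add: card_kron_vertices)
    finally show ?thesis
      using measure_pmf.prob_compl[of "good n" "K n"] by (simp add: Compl_eq_Diff_UNIV)
  qed
  \<comment> \<open>Since \<open>s > 1\<close>, \<open>s ^ n / n^2\<close> outgrows
    \<open>n * ln 2\<close>, so the exponential beats the \<open>2 ^ n\<close> vertices. The factor
    4 comes from two bad events per vertex with two tails each.\<close>
  have lim: "(\<lambda>n. 1 - 2 ^ n * (4 * exp (- (s ^ n) * (1 / real n)\<^sup>2 / 4))) \<longlonglongrightarrow> 1"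
    using s by real_asymp
  have ev: "\<forall>\<^sub>F n in sequentially.
      1 - 2 ^ n * (4 * exp (- (s ^ n) * (1 / real n)\<^sup>2 / 4)) \<le> measure_pmf.prob (K n) (good n)"
    by (intro eventually_sequentiallyI[of 1] lower) simp
  have "(\<lambda>n. measure_pmf.prob (K n) (good n)) \<longlonglongrightarrow> 1"
    by (rule tendsto_sandwich[OF ev _ lim tendsto_const]) simp
  then have "(\<lambda>n. measure_pmf.prob (kronecker_graph n (kron_matrix \<alpha> \<beta> \<gamma>)) (good n)) \<longlonglongrightarrow> 1"
    using assms by (simp add: K_def)
  then show ?thesis
    unfolding good_def by (intro exI[of _ \<delta>] exI[of _ \<epsilon>] conjI \<delta> \<epsilon>)
qed

end
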